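(* Let $q=p^k$ for some odd prime $p$ and some integer $k>0$. Let $Q,R,S$ be integers each of the form $p^i$ for some integer $i\ge 0$ (the exponents may differ). Let $r>0$ be an integer such that $r\equiv Q+R+S\pmod{q+1}$ and $\gcd(r,q-1)=1$. For $j\in\{1,2\}$ let $f_j(X):=X^rB_j(X^{q-1})$, where $$B_1(X):=X^{Q+R}+X^{Q+S}+X^{R+S}-1,$$ $$B_2(X):=X^{Q+R}-X^{Q+S}-X^{R+S}-1.$$ Then the following hold. (1) $f_1(X)$ permutes $\mathbb{F}_{q^2}$ if one of the following holds: (a) $q\equiv 1\pmod 4$ and $(Q,R,S)\equiv\pm(1,1,1)\pmod 4$ and $\gcd(Q+R+S,q+1)=1$; (b) $q\equiv -1\pmod 4$ and $(Q,R,S)\equiv\pm(1,1,1)\pmod 4$ and $\gcd(Q+R+S,q-1)=1$; (c) $q\equiv 1\pmod 4$ and $(Q,R,S)\equiv\pm(1,1,-1)\pmod 4$ and $\gcd(Q+R-S,q+1)=1$. (2) $f_2(X)$ permutes $\mathbb{F}_{q^2}$ if one of the following holds: (a) $q\equiv 1\pmod 4$ and $(Q,R,S)\equiv\pm(1,1,-1)\pmod 4$ and $\gcd(Q+R+S,q+1)=1$; (b) $q\equiv -1\pmod 4$ and $(Q,R,S)\equiv\pm(1,1,-1)\pmod 4$ and $\gcd(Q+R+S,q-1)=1$; (c) $q\equiv 1\pmod 4$ and $(Q,R,S)\equiv\pm(1,1,1)\pmod 4$ and $\gcd(Q+R-S,q+1)=1$; (d) $q\equiv 1\pmod 4$ and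 $(Q,R,S)\equiv\pm(1,-1,1)\pmod 4$ and $\gcd(Q-R-S,q+1)=1$.
   Context: A polynomial $f(X)\in\mathbb{F}_{q^2}[X]$ permutes $\mathbb{F}_{q^2}$ if the map $\alpha\mapsto f(\alpha)$ is a bijection of $\mathbb{F}_{q^2}$. For integers $\epsilon_1,\epsilon_2,\epsilon_3$, the notation $(Q,R,S)\equiv\pm(\epsilon_1,\epsilon_2,\epsilon_3)\pmod 4$ means that there is a single sign $s\in\{1,-1\}$ with $Q\equiv s\epsilon_1$, $R\equiv s\epsilon_2$, $S\equiv s\epsilon_3\pmod 4$. *)

theory Defs
  imports "HOL-Library.Cardinality" "HOL-Computational_Algebra.Computational_Algebra" "HOL-Number_Theory.Cong"
begin

definition B1 :: "nat \<Rightarrow> nat \<Rightarrow> nat \<Rightarrow> 'a::comm_ring_1 poly" where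
  "B1 Q R S = monom 1 (Q + R) + monom 1 (Q + S) + monom 1 (R + S) - 1"

definition B2 :: "nat \<Rightarrow> nat \<Rightarrow> nat \<Rightarrow> 'a::comm_ring_1 poly" where
  "B2 Q R S = monom 1 (Q + R) - monom 1 (Q + S) - monom 1 (R + S) - 1"

definition twist_poly :: "nat \<Rightarrow> nat \<Rightarrow> 'a::comm_ring_1 poly \<Rightarrow> 'a poly" where
  "twist_poly q r B = monom 1 r * pcompose B (monom 1 (q - 1))"

definition permutes_field :: "'a::{finite,field} poly \<Rightarrow> bool" where
  "permutes_field f \<longleftrightarrow> bij (poly f)"

text \<open>$(Q,R,S) \equiv \pm(e_1,e_2,e_3) \pmod 4$: one common sign for all three entries.\<close>

definition pm_cong4 :: "nat \<times> nat \<times> nat \<Rightarrow> int \<times> int \<times> int \<Rightarrow> bool" where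
  "pm_cong4 = (\<lambda>(Q, R, S) (e1, e2, e3).
     \<exists>s\<in>{1, -1}. [int Q = s * e1] (mod 4) \<and> [int R = s * e2] (mod 4) \<and> [int S = s * e3] (mod 4))"

end

theory Submission
  imports Defs "HOL-Number_Theory.Residues"
begin

text \<open>
  On \<open>x \<noteq> 0\<close> the map is \<open>x \<mapsto> x\<^sup>r D(t)\<close>, where \<open>t = x\<^sup>q\<^sup>-\<^sup>1\<close> satisfies \<open>t\<^sup>q\<^sup>+\<^sup>1 = 1\<close> and \<open>D = B\<^sub>j\<close>.
  Frobenius inverts such \<open>t\<close>, so the congruence for \<open>r\<close> turns the \<open>q\<close>-th power of this value
  into \<open>x\<^sup>r N(t)\<close>, where \<open>N(t) = t\<^sup>Q\<^sup>+\<^sup>R\<^sup>+\<^sup>S D(1/t)\<close>. Hence the value determines the ratio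
  \<open>N(t) / D(t)\<close>, and once \<open>t\<close> is recovered from it, \<open>x\<close> is known up to a factor whose
  order divides both \<open>r\<close> and \<open>q - 1\<close>, that is, known exactly.

  The ratio is the addition formula for the tangent: up to sign, \<open>N(t) / D(t)\<close> is
  \<open>tan (\<alpha> + \<beta> \<plusminus> \<gamma>)\<close> in terms of \<open>tan \<alpha> = t\<^sup>Q\<close>, \<open>tan \<beta> = t\<^sup>R\<close>, \<open>tan \<gamma> = t\<^sup>S\<close>, with the plus
  sign for \<open>B\<^sub>1\<close> and the minus sign for \<open>B\<^sub>2\<close>. The Cayley transform
  \<open>u = (1 + i t) / (1 - i t)\<close>, with \<open>i\<^sup>2 = -1\<close>, plays the role of \<open>exp (2 i \<theta>)\<close> and turns the
  addition of angles into multiplication. Because \<open>Q\<close> is a power of the characteristic and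
  \<open>i\<^sup>Q = \<plusminus> i\<close> according to \<open>Q\<close> modulo 4, replacing \<open>t\<close> by \<open>t\<^sup>Q\<close> replaces \<open>u\<close> by
  \<open>u\<^sup>Q\<close> or its inverse. In the coordinate \<open>u\<close> the map \<open>t \<mapsto> N(t) / D(t)\<close> is therefore a
  power map \<open>u \<mapsto> u\<^sup>n\<close> with \<open>n = \<plusminus>Q \<plusminus> R \<plusminus> S\<close>. Two values of \<open>u\<close> other than \<open>0\<close> and \<open>\<infinity>\<close> have a
  quotient whose order divides \<open>q + 1\<close> or \<open>q - 1\<close>, for \<open>q \<equiv> 1\<close> and \<open>q \<equiv> -1\<close> modulo 4 respectively,
  so the gcd hypotheses make the power map injective.

  All seven cases are instances of \<open>twisted_tangent_permutes\<close>. The injectivity of the power map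
  is \<open>cayley_power_inject\<close>, which avoids the point at infinity by cross-multiplying.
\<close>

section \<open>Finite fields and coprime exponents\<close>

text \<open>Multiplication by \<open>x\<close> permutes the nonzero elements, so it preserves their product.\<close>

lemma finite_field_unit_power:
  fixes x :: "'a :: {finite,field}"
  assumes "x \<noteq> 0"
  shows "x ^ (CARD('a) - 1) = 1"
proof -
  have "(\<Prod>y\<in>UNIV - {0}. x * y) = \<Prod>(UNIV - {0})"
    using assms by (intro prod.reindex_bij_witness[of _ "\<lambda>y. y / x" "(*) x"]) auto
  moreover have "\<Prod>(UNIV - {0 :: 'a}) \<noteq> 0"
    by simp
  ultimately show ?thesis
    by (simp add: prod.distrib card_Diff_singleton)
qed

lemma finite_field_CHAR_eq:
  assumes "prime p" "CARD('a :: {finite,field}) = p ^ n"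
  shows "CHAR('a) = p"
proof -
  have "prime CHAR('a)"
    by (intro prime_CHAR_semidom finite_imp_CHAR_pos) simp
  moreover have "CHAR('a) dvd p ^ n"
    using CHAR_dvd_CARD[where 'a = 'a] assms by simp
  ultimately show ?thesis
    using assms prime_dvd_power primes_dvd_imp_eq by blast
qed

text \<open>
  A polynomial of degree \<open>2 m\<close> cannot vanish on all \<open>4 m\<close> units, so some unit \<open>z\<close> has
  \<open>z\<^sup>2\<^sup>m \<noteq> 1\<close>. As \<open>z\<^sup>4\<^sup>m = 1\<close>, this power is \<open>-1\<close>.
\<close>

lemma finite_field_sqrt_minus_one:
  assumes "CARD('a :: {finite,field}) = 4 * m + 1" "m > 0"
  obtains i :: "'a :: {finite,field}" where "i * i = -1"
proof -
  define f where "f = Polynomial.monom 1 (2 * m) + [:- 1 :: 'a:]"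
  have deg: "degree f = 2 * m"
    unfolding f_def using assms(2) by (subst degree_add_eq_left) (simp_all add: degree_monom_eq)
  then have "f \<noteq> 0"
    using assms(2) by (metis degree_0 mult_eq_0_iff not_gr_zero zero_neq_numeral)
  then have "card {x. poly f x = 0} < card (UNIV - {0 :: 'a})"
    using card_poly_roots_bound[of f] deg assms by (simp add: card_Diff_singleton)
  then have "\<not> UNIV - {0} \<subseteq> {x. poly f x = 0}"
    by (meson card_mono finite leD)
  then obtain z where z: "z \<noteq> 0" "poly f z \<noteq> 0"
    by blast
  have "(z ^ (2 * m)) ^ 2 = 1"
    using finite_field_unit_power[OF z(1)] assms by (simp flip: power_mult add: mult.commute)
  with z(2) have "z ^ (2 * m) = -1"
    by (simp add: f_def poly_monom power2_eq_1_iff)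
  then have "z ^ m * z ^ m = -1"
    by (simp flip: power_add add: mult_2)
  then show ?thesis
    using that by blast
qed

text \<open>
  Integer exponents are needed because the exponent \<open>\<plusminus>Q \<plusminus> R \<plusminus> S\<close> of the power map may be negative.
\<close>

lemma power_int_coprime_eq_1:
  fixes w :: "'a :: field"
  assumes "w \<noteq> 0" "w powi m = 1" "w powi n = 1" "gcd m n = 1"
  shows "w = 1"
proof -
  obtain u v where "u * m + v * n = 1"
    using bezout_int[of m n] assms(4) by auto
  then have "w = w powi (u * m + v * n)"
    by simp
  also have "\<dots> = (w powi m) powi u * (w powi n) powi v"
    using assms(1) by (simp add: power_int_add power_int_mult[symmetric] mult.commute)
  finally show ?thesis
    using assms by simp
qed

lemma power_cong_exponent:
  fixes x :: "'a :: monoid_mult"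
  assumes "x ^ m = 1" "[a = b] (mod m)"
  shows "x ^ a = x ^ b"
proof -
  have "x ^ n = x ^ (n mod m)" for n
    using assms(1) by (metis div_mult_mod_eq mult.commute mult_1 power_add power_mult power_one)
  then show ?thesis
    using assms(2) unfolding cong_def by metis
qed

lemma sqrt_minus_one_power:
  fixes i :: "'a :: comm_ring_1"
  assumes "i * i = -1" "[int n = e] (mod 4)" "e \<in> {1, -1}"
  shows "i ^ n = of_int e * i"
proof -
  have i4: "i ^ 4 = 1"
    using assms(1) by (simp add: eval_nat_numeral)
  have *: "i ^ n = i ^ (n mod 4)"
    by (rule power_cong_exponent[OF i4]) (simp add: cong_def)
  have "e = 1 \<and> int n mod 4 = 1 \<or> e = -1 \<and> int n mod 4 = 3"
    using assms(2,3) by (auto simp: cong_def)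
  moreover have "int n mod 4 = int (n mod 4)"
    by (simp add: zmod_int)
  ultimately have "e = 1 \<and> n mod 4 = 1 \<or> e = -1 \<and> n mod 4 = 3"
    by linarith
  then consider "e = 1" "n mod 4 = 1" | "e = -1" "n mod 4 = 3"
    by blast
  then show ?thesis
    unfolding * by cases (simp_all add: power3_eq_cube assms(1))
qed

section \<open>The Cayley transform and the tangent addition formula\<close>

text \<open>
  For \<open>e = 1\<close> and \<open>e = -1\<close> these are the numerator and the denominator of the Cayley transform
  \<open>(1 + i t) / (1 - i t)\<close>. Keeping them apart leaves room for the value infinity, and the sign
  as a parameter lets inversion of the transform be a change of sign.
\<close>

definition cayley_factor :: "'a \<Rightarrow> int \<Rightarrow> 'a \<Rightarrow> 'a :: comm_ring_1"
  where "cayley_factor i e t = 1 + of_int e * i * t"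

text \<open>
  Passing from \<open>t\<close> to \<open>t\<^sup>n\<close> raises the Cayley transform to the power \<open>e n\<close>, where the sign
  \<open>e\<close> records how the Frobenius power acts on \<open>i\<close>.
\<close>

lemma cayley_factor_power:
  fixes i t :: "'a :: comm_ring_1"
  assumes frob: "\<And>z :: 'a. (1 + z) ^ n = 1 + z ^ n" and n: "odd n"
    and "i ^ n = of_int e * i" and s: "s \<in> {1, -1}"
  shows "cayley_factor i s t ^ n = cayley_factor i (s * e) (t ^ n)"
proof -
  have "cayley_factor i s t ^ n = 1 + of_int s ^ n * i ^ n * t ^ n"
    by (simp add: cayley_factor_def frob power_mult_distrib)
  also have "of_int s ^ n = (of_int s :: 'a)"
    using s n by auto
  finally show ?thesis
    by (simp add: cayley_factor_def assms(3) mult.assoc)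
qed

text \<open>
  The addition formula: for \<open>d = s = 1\<close> the real and imaginary parts of
  \<open>(1 + i x) (1 + i y) (1 + i z)\<close> are the denominator and the numerator of \<open>tan (\<alpha> + \<beta> + \<gamma>)\<close>.
  The sign \<open>d\<close> reverses the third angle and \<open>s\<close> is complex conjugation.
\<close>

lemma cayley_factor_product:
  assumes "i * i = -1" "d \<in> {1, -1 :: int}" "s \<in> {1, -1}"
  shows "cayley_factor i s x * cayley_factor i s y * cayley_factor i (s * d) z =
    of_int (s * d) * i * (z + of_int d * (x + y) - x * y * z) - (x * y + of_int d * (x * z + y * z) - 1)"
proof -
  have i: "i * (i * u) = - u" for u
    using assms(1) by (simp flip: mult.assoc)
  show ?thesis
    using assms(2,3) by (auto simp: cayley_factor_def algebra_simps i assms(1))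
qed

text \<open>
  The equation between \<open>X\<close> and \<open>Y\<close> is \<open>u\<^sup>n = v\<^sup>n\<close>, cross-multiplied, for their Cayley
  transforms \<open>u\<close>, \<open>v\<close> and \<open>n = a Q + b R + c S\<close>. Conjugation by Frobenius sends
  \<open>w = u / v\<close> to its power \<open>-\<epsilon>\<close>, so \<open>w\<close> has order dividing \<open>q + \<epsilon>\<close>, which is coprime to \<open>n\<close>,
  and \<open>u = v\<close> follows. If \<open>\<epsilon> = 1\<close>, the values \<open>0\<close> and \<open>\<infinity>\<close> of \<open>u\<close> and \<open>v\<close> are excluded by
  hypothesis. If \<open>\<epsilon> = -1\<close>, they do occur, but then the three signs agree and the
  equation is a single identity between \<open>(Q + R + S)\<close>-th powers, so that both of its sides vanish
  at once.
\<close>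

lemma cayley_power_inject:
  fixes i X Y :: "'a :: field" and a b c \<epsilon> :: int
  defines "h \<equiv> cayley_factor i"
  assumes i: "i * i = -1" and two: "(2 :: 'a) \<noteq> 0"
    and signs: "a \<in> {1, -1}" "b \<in> {1, -1}" "c \<in> {1, -1}" "\<epsilon> \<in> {1, -1}"
    and frob: "\<And>z :: 'a. (1 + z) ^ q = 1 + z ^ q" and q: "odd q" and iq: "i ^ q = of_int \<epsilon> * i"
    and X: "X ^ (q + 1) = 1" and Y: "Y ^ (q + 1) = 1"
    and eq: "h a X ^ Q * h b X ^ R * h c X ^ S * (h (-a) Y ^ Q * h (-b) Y ^ R * h (-c) Y ^ S) =
             h (-a) X ^ Q * h (-b) X ^ R * h (-c) X ^ S * (h a Y ^ Q * h b Y ^ R * h c Y ^ S)"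
    and cop: "gcd (a * int Q + b * int R + c * int S) (int q + \<epsilon>) = 1"
    and nz: "\<epsilon> = 1 \<longrightarrow> (\<forall>s\<in>{1, -1}. h s X \<noteq> 0 \<and> h s Y \<noteq> 0)"
    and eq_signs: "\<epsilon> = -1 \<longrightarrow> a = b \<and> b = c" and pos: "Q > 0"
  shows "X = Y"
proof -
  \<comment> \<open>The quotient \<open>L 1 / L (-1)\<close> is the quotient of the Cayley transforms of \<open>X\<close> and \<open>Y\<close>.\<close>
  define L where "L s = h s X * h (-s) Y" for s
  have eqL: "L a ^ Q * L b ^ R * L c ^ S = L (-a) ^ Q * L (-b) ^ R * L (-c) ^ S"
    using eq unfolding L_def by (simp add: power_mult_distrib mult_ac)
  \<comment> \<open>Frobenius inverts \<open>t\<close>; multiplying by \<open>t\<close> clears the denominator of \<open>1 \<plusminus> i / t\<close>.\<close>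
  have hq: "t * h s t ^ q = of_int (s * \<epsilon>) * i * h (- s * \<epsilon>) t"
    if "t ^ (q + 1) = 1" "s \<in> {1, -1}" for t s
  proof -
    have t: "t * t ^ q = 1"
      using that by simp
    have "h s t ^ q = h (s * \<epsilon>) (t ^ q)"
      unfolding h_def by (rule cayley_factor_power[OF frob q iq that(2)])
    then have "t * h s t ^ q = t + of_int (s * \<epsilon>) * i * (t * t ^ q)"
      by (simp add: h_def cayley_factor_def algebra_simps)
    also have "\<dots> = t + of_int (s * \<epsilon>) * i"
      by (simp only: t) simp
    also have "\<dots> = of_int (s * \<epsilon>) * i * h (- s * \<epsilon>) t"
    proof -
      have "i * (i * t) = - t" 
        using i by (simp flip: mult.assoc)
      then show ?thesis
        using that(2) signs(4) by (auto simp: h_def cayley_factor_def algebra_simps)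
    qed
    finally show ?thesis .
  qed
  have Lq: "X * Y * L s ^ q = L (- s * \<epsilon>)" if s: "s \<in> {1, -1}" for s
  proof -
    have "X * Y * L s ^ q = (X * h s X ^ q) * (Y * h (-s) Y ^ q)"
      by (simp add: L_def power_mult_distrib)
    also have "\<dots> = L (- s * \<epsilon>) * - (i * i)"
      using s signs(4) by (subst hq[OF X s], subst hq[OF Y]) (auto simp: L_def)
    finally show ?thesis
      by (simp add: i)
  qed
  have XY: "X \<noteq> 0" "Y \<noteq> 0"
    using X Y by (auto simp: power_0_left)
  have diff: "L 1 - L (-1) = 2 * i * (X - Y)"
    by (simp add: L_def h_def cayley_factor_def algebra_simps)
  have "L 1 = L (-1)"
  proof (cases "L 1 = 0 \<or> L (-1) = 0")
    case True
    with nz signs(4) have "\<epsilon> = -1"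
      by (auto simp: L_def)
    with eq_signs eqL have "L a ^ (Q + R + S) = L (-a) ^ (Q + R + S)"
      by (simp add: power_add)
    with True signs(1) pos show ?thesis
      by (auto simp: power_0_left)
  next
    case False
    define w where "w = L 1 / L (-1)"
    have w0: "w \<noteq> 0"
      using False by (simp add: w_def)
    have ratio: "L s / L (-s) = w powi s" if "s \<in> {1, -1}" for s
      using that by (auto simp: w_def power_int_minus)
    have nzL: "L s \<noteq> 0" if "s \<in> {1, -1}" for s
      using that False by auto
    have "w powi (a * int Q + b * int R + c * int S)
        = (L a / L (-a)) ^ Q * (L b / L (-b)) ^ R * (L c / L (-c)) ^ S"
      unfolding ratio[OF signs(1)] ratio[OF signs(2)] ratio[OF signs(3)] power_int_power'
        power_int_add[OF disjI1[OF w0]] ..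
    also have "\<dots> = (L a ^ Q * L b ^ R * L c ^ S) / (L (-a) ^ Q * L (-b) ^ R * L (-c) ^ S)"
      by (simp only: power_divide times_divide_times_eq)
    also have "\<dots> = 1"
    proof -
      have "L (-a) \<noteq> 0" "L (-b) \<noteq> 0" "L (-c) \<noteq> 0"
        using signs(1-3) by (auto intro!: nzL)
      then show ?thesis
        unfolding eqL by (intro divide_self no_zero_divisors power_not_zero)
    qed
    finally have "w powi (a * int Q + b * int R + c * int S) = 1" .
    moreover have "w powi (int q + \<epsilon>) = 1"
    proof -
      have "w ^ q = (X * Y * L 1 ^ q) / (X * Y * L (-1) ^ q)"
        unfolding w_def power_divide using XY by (subst mult_divide_mult_cancel_left) auto
      also have "\<dots> = L (- \<epsilon>) / L \<epsilon>"
        using Lq[of 1] Lq[of "-1"] by simp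
      also have "\<dots> = w powi (-\<epsilon>)"
        using ratio[of "-\<epsilon>"] signs(4) by auto
      finally have w: "w powi int q = inverse (w powi \<epsilon>)"
        by (simp only: power_int_of_nat power_int_minus)
      have "w powi \<epsilon> \<noteq> 0"
        using w0 by simp
      then show ?thesis
        unfolding power_int_add[OF disjI1[OF w0]] w by (rule left_inverse)
    qed
    ultimately have "w = 1"
      by (rule power_int_coprime_eq_1[OF w0 _ _ cop])
    then show ?thesis
      using False by (simp add: w_def)
  qed
  moreover have "i \<noteq> 0"
    using i by auto
  ultimately show ?thesis
    using diff two by auto
qed


section \<open>The permutation criterion\<close>

text \<open>
  Reciprocal tangents belong to complementary angles; multiplied by \<open>x y z\<close>, the denominator of
  the addition formula at the reciprocals becomes its numerator up to sign.
\<close>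

lemma tangent_reciprocal:
  fixes x y z e :: "'a :: comm_ring_1"
  assumes "x * x' = 1" "y * y' = 1" "z * z' = 1"
  shows "x * y * z * (x' * y' + e * (x' * z' + y' * z') - 1) = z + e * (x + y) - x * y * z"
proof -
  have "x * y * z * (x' * y') = (x * x') * (y * y') * z"
       "x * y * z * (x' * z') = (x * x') * (z * z') * y"
       "x * y * z * (y' * z') = (y * y') * (z * z') * x"
    by (simp_all only: mult_ac)
  then have *: "x * y * z * (x' * y') = z" "x * y * z * (x' * z') = y" "x * y * z * (y' * z') = x"
    using assms by simp_all
  have "x * y * z * (x' * y' + e * (x' * z' + y' * z') - 1)
      = x * y * z * (x' * y') + e * (x * y * z * (x' * z') + x * y * z * (y' * z')) - x * y * z"
    by (simp only: ring_distribs mult_ac mult_1)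
  then show ?thesis
    unfolding * by (simp only: add.commute)
qed

text \<open>
  The signs \<open>a\<close>, \<open>b\<close>, \<open>c\<close>, \<open>\<epsilon>\<close> say how the powers \<open>Q\<close>, \<open>R\<close>, \<open>S\<close>, \<open>q\<close> act on \<open>i\<close>, and
  \<open>d\<close> selects \<open>B\<^sub>1\<close> or \<open>B\<^sub>2\<close>. Since the second polynomial is the first one with the tangent
  \<open>x\<^sup>S\<close> negated, \<open>d\<close> enters the exponent of the power map as a factor of \<open>c\<close>. For \<open>\<epsilon> = -1\<close> the
  points \<open>t = \<plusminus>i\<close> satisfy \<open>t\<^sup>q\<^sup>+\<^sup>1 = 1\<close>, and the last hypothesis keeps \<open>B\<close> from vanishing there.
\<close>

lemma twisted_tangent_permutes:
  fixes B :: "'a :: {finite,field} poly" and d \<epsilon> a b c :: int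
  assumes p: "prime p" "odd p" and k: "k > 0" and q: "q = p ^ k" and card: "CARD('a) = q ^ 2"
    and QRS: "\<exists>j. Q = p ^ j" "\<exists>j. R = p ^ j" "\<exists>j. S = p ^ j"
    and r: "r > 0" "[r = Q + R + S] (mod (q + 1))" "gcd r (q - 1) = 1"
    and signs: "a \<in> {1, -1}" "b \<in> {1, -1}" "c \<in> {1, -1}" "d \<in> {1, -1}" "\<epsilon> \<in> {1, -1}"
    and mod4: "[int Q = a] (mod 4)" "[int R = b] (mod 4)" "[int S = c] (mod 4)" "[int q = \<epsilon>] (mod 4)"
    and B: "\<And>x. poly B x = x ^ (Q + R) + of_int d * (x ^ (Q + S) + x ^ (R + S)) - 1"
    and cop: "gcd (a * int Q + b * int R + d * c * int S) (int q + \<epsilon>) = 1"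
    and eq_signs: "\<epsilon> = -1 \<longrightarrow> a = b \<and> b = d * c"
  shows "permutes_field (twist_poly q r B)"
proof -
  have q_odd: "odd q"
    using p q by simp
  have q_ge: "q \<ge> 3"
  proof -
    have "q > 1"
      using p k q by (metis one_less_power prime_gt_1_nat)
    with q_odd show ?thesis
      by (auto elim!: oddE)
  qed
  have odd: "odd Q" "odd R" "odd S"
    using QRS p by auto
  have pos: "Q > 0"
    using odd by (auto intro: Nat.gr0I)
  have CHAR: "CHAR('a) = p"
    using finite_field_CHAR_eq[where 'a = 'a, OF p(1), of "k * 2"] card q by (simp add: power_mult)
  have frob: "(x + y) ^ p ^ j = x ^ p ^ j + y ^ p ^ j" for x y :: 'a and j
    by (rule freshmans_dream') (simp_all add: CHAR p)
  have frob1: "(1 + z) ^ n = 1 + z ^ n" if "\<exists>j. n = p ^ j" for n and z :: 'a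
    using that frob[of 1 z] by auto
  have two: "(2 :: 'a) \<noteq> 0"
  proof
    assume "(2 :: 'a) = 0"
    then have "of_nat 2 = (0 :: 'a)"
      by simp
    then have "p dvd 2"
      using of_nat_eq_0_iff_char_dvd[where 'a = 'a] CHAR by metis
    then show False
      using p by (metis prime_nat_iff two_is_prime_nat even_numeral dvd_refl primes_dvd_imp_eq)
  qed
  \<comment> \<open>The square of an odd number is 1 modulo 4, so the field contains a square root of \<open>-1\<close>.\<close>
  obtain i :: 'a where i: "i * i = -1"
  proof -
    obtain m where m: "q = 2 * m + 1"
      using q_odd by (elim oddE)
    show ?thesis
    proof (rule finite_field_sqrt_minus_one[of "m * m + m", where 'a = 'a])
      show "CARD('a) = 4 * (m * m + m) + 1"
        using card m by (simp add: power2_eq_square algebra_simps)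
      show "m * m + m > 0"
        using m q_ge by auto
    qed (use that in auto)
  qed
  have i_pow: "i ^ Q = of_int a * i" "i ^ R = of_int b * i" "i ^ S = of_int c * i" "i ^ q = of_int \<epsilon> * i"
    using sqrt_minus_one_power[OF i] mod4 signs by auto

  define h where "h = cayley_factor i"
  define D where "D t = poly B t" for t
  define N where "N t = t ^ S + of_int d * (t ^ Q + t ^ R) - t ^ (Q + R + S)" for t :: 'a
  define P where "P s t = h (s * a) t ^ Q * h (s * b) t ^ R * h (s * (d * c)) t ^ S" for s t

  have P_eq: "P s t = of_int (s * d) * i * N t - D t" if s: "s \<in> {1, -1}" for s t
  proof -
    have "h (s * a) t ^ Q = h s (t ^ Q)" "h (s * b) t ^ R = h s (t ^ R)"
         "h (s * (d * c)) t ^ S = h (s * d) (t ^ S)"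
      unfolding h_def using s signs
      by (auto simp: cayley_factor_power[OF frob1[OF QRS(1)] odd(1) i_pow(1)]
          cayley_factor_power[OF frob1[OF QRS(2)] odd(2) i_pow(2)] cayley_factor_power[OF frob1[OF QRS(3)] odd(3) i_pow(3)])
    then have "P s t = h s (t ^ Q) * h s (t ^ R) * h (s * d) (t ^ S)"
      by (simp add: P_def)
    also have "\<dots> = of_int (s * d) * i * N t - D t"
      unfolding h_def cayley_factor_product[OF i signs(4) s] by (simp add: N_def D_def B power_add)
    finally show ?thesis .
  qed

  have DN: "t ^ (Q + R + S) * D t ^ q = N t" if "t ^ (q + 1) = 1" for t
  proof -
    have add_q: "(x + y) ^ q = x ^ q + y ^ q" for x y :: 'a
      unfolding q by (rule frob)
    have diff_q: "(x - y) ^ q = x ^ q - y ^ q" for x y :: 'a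
      using add_q[of x "-y"] q_odd by simp
    have d_q: "of_int d ^ q = (of_int d :: 'a)"
      using signs q_odd by auto
    have "D t ^ q = D (t ^ q)"
      by (simp add: D_def B add_q diff_q d_q power_mult_distrib mult.commute flip: power_mult)
    moreover have "t ^ (Q + R + S) * D (t ^ q) = N t"
    proof -
      have inv: "t ^ n * (t ^ q) ^ n = 1" for n
        using that by (simp flip: power_mult_distrib)
      show ?thesis
        unfolding D_def B N_def power_add by (rule tangent_reciprocal) (rule inv)+
    qed
    ultimately show ?thesis
      by simp
  qed

  \<comment> \<open>A zero \<open>t = \<plusminus>i\<close> would satisfy \<open>t\<^sup>q\<^sup>+\<^sup>1 = i\<^sup>2 = -1\<close> when \<open>q \<equiv> 1\<close> modulo 4.\<close>
  have h_nz: "h s t \<noteq> 0" if "\<epsilon> = 1" "t ^ (q + 1) = 1" "s \<in> {1, -1}" for s t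
  proof
    assume "h s t = 0"
    then have "of_int s * i * t = -1"
      unfolding h_def cayley_factor_def by (metis add_eq_0_iff)
    then have "(of_int s * i * t) ^ (q + 1) = 1"
      using q_odd by simp
    moreover have "(of_int s :: 'a) ^ (q + 1) = 1"
      using that(3) q_odd by auto
    ultimately have "i ^ (q + 1) = 1"
      using that(2) by (simp only: power_mult_distrib mult_1 mult_1_right)
    then show False
      using i_pow(4) that(1) i two by (simp add: eq_neg_iff_add_eq_0)
  qed

  \<comment> \<open>If \<open>D\<close> vanishes then so does its conjugate multiple \<open>N\<close>, hence both \<open>P 1\<close> and \<open>P (-1)\<close>.
    For \<open>\<epsilon> = 1\<close> none of their factors can vanish. For \<open>\<epsilon> = -1\<close> they are powers of \<open>1 + i t\<close> and
    \<open>1 - i t\<close>, which have no common zero in odd characteristic.\<close>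
  have D_nz: "D t \<noteq> 0" if t: "t ^ (q + 1) = 1" for t
  proof
    assume D0: "D t = 0"
    then have "N t = 0"
      using DN[OF t] q_ge by (simp add: power_0_left)
    with D0 have P0: "P 1 t = 0" "P (-1) t = 0"
      by (simp_all add: P_eq)
    show False
    proof (cases "\<epsilon> = 1")
      case True
      then show False
        using P0(1) h_nz[OF True t] signs by (auto simp: P_def)
    next
      case False
      with eq_signs signs have "a = b" "d * c = b"
        by auto
      with P0 have "h b t = 0" "h (-b) t = 0"
        by (auto simp: P_def)
      then have "h b t + h (-b) t = 0"
        by simp
      then show False
        using two by (simp add: h_def cayley_factor_def)
    qed
  qed

  have f: "poly (twist_poly q r B) x = x ^ r * D (x ^ (q - 1))" for x
    by (simp add: twist_poly_def D_def poly_monom poly_pcompose)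
  have unit: "(x ^ (q - 1)) ^ (q + 1) = 1" if "x \<noteq> 0" for x :: 'a
  proof -
    have "(q - 1) * (q + 1) = CARD('a) - 1"
      using card by (simp add: power2_eq_square algebra_simps)
    then show ?thesis
      using finite_field_unit_power[OF that] by (metis power_mult)
  qed
  have f_q: "(x ^ r * D (x ^ (q - 1))) ^ q = x ^ r * N (x ^ (q - 1))" if "x \<noteq> 0" for x
  proof -
    have "(x ^ r) ^ q = x ^ r * (x ^ (q - 1)) ^ r"
    proof -
      have "r * q = r + (q - 1) * r"
        using q_ge by (cases q) auto
      then show ?thesis
        by (simp flip: power_mult power_add)
    qed
    also have "(x ^ (q - 1)) ^ r = (x ^ (q - 1)) ^ (Q + R + S)"
      by (rule power_cong_exponent[OF unit[OF that] r(2)])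
    finally show ?thesis
      using DN[OF unit[OF that]] by (simp add: power_mult_distrib mult.assoc)
  qed

  have "inj (poly (twist_poly q r B))"
  proof (rule injI)
    fix x y :: 'a
    assume eq: "poly (twist_poly q r B) x = poly (twist_poly q r B) y"
    define X Y where "X = x ^ (q - 1)" and "Y = y ^ (q - 1)"
    have zero_iff: "poly (twist_poly q r B) z = 0 \<longleftrightarrow> z = 0" for z
      using D_nz[OF unit[of z]] r(1) by (auto simp: f)
    show "x = y"
    proof (cases "x = 0 \<or> y = 0")
      case True
      then show ?thesis
        using eq zero_iff by metis
    next
      case False
      then have X: "X ^ (q + 1) = 1" and Y: "Y ^ (q + 1) = 1"
        using unit by (auto simp: X_def Y_def)
      have fD: "x ^ r * D X = y ^ r * D Y"
        using eq by (simp add: f X_def Y_def)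
      have fN: "x ^ r * N X = y ^ r * N Y"
        using f_q False fD by (metis X_def Y_def)
      have "(x ^ r * y ^ r) * (N X * D Y) = (x ^ r * y ^ r) * (N Y * D X)"
      proof -
        have "(x ^ r * y ^ r) * (N X * D Y) = (x ^ r * N X) * (y ^ r * D Y)"
          by (simp only: mult_ac)
        also have "\<dots> = (y ^ r * N Y) * (x ^ r * D X)"
          by (simp only: fN fD)
        finally show ?thesis
          by (simp only: mult_ac)
      qed
      then have ND: "N X * D Y = N Y * D X"
        using False by simp
      have "P 1 X * P (-1) Y = P (-1) X * P 1 Y"
        using ND by (simp add: P_eq algebra_simps)
      then have PP: "h a X ^ Q * h b X ^ R * h (d * c) X ^ S * (h (-a) Y ^ Q * h (-b) Y ^ R * h (- (d * c)) Y ^ S)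
          = h (-a) X ^ Q * h (-b) X ^ R * h (- (d * c)) X ^ S * (h a Y ^ Q * h b Y ^ R * h (d * c) Y ^ S)"
        by (simp add: P_def)
      have "X = Y"
      proof (rule cayley_power_inject[OF i two signs(1,2) _ signs(5) _ q_odd i_pow(4) X Y PP[unfolded h_def] cop])
        show "d * c \<in> {1, -1}"
          using signs by auto
        show "(1 + z) ^ q = 1 + z ^ q" for z :: 'a
          using frob1 q by blast
        show "\<epsilon> = 1 \<longrightarrow> (\<forall>s\<in>{1, -1}. cayley_factor i s X \<noteq> 0 \<and> cayley_factor i s Y \<noteq> 0)"
          using h_nz X Y unfolding h_def by blast
      qed (fact eq_signs pos)+
      then have "x ^ r = y ^ r"
        using fD D_nz X by simp
      have "x / y = 1"
      proof (rule power_int_coprime_eq_1)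
        show "(x / y) powi int r = 1" "(x / y) powi int (q - 1) = 1"
          using \<open>x ^ r = y ^ r\<close> \<open>X = Y\<close> False by (simp_all add: X_def Y_def power_divide)
        show "gcd (int r) (int (q - 1)) = 1"
          using r(3) by (metis gcd_int_int_eq of_nat_1)
      qed (use False in auto)
      then show ?thesis
        using False by simp
    qed
  qed
  then show ?thesis
    unfolding permutes_field_def by (simp add: bij_def finite_UNIV_inj_surj)
qed

theorem corollary1p6:
  fixes p k q Q R S r :: nat
    and f1 f2 :: "'a::{finite,field} poly"
  assumes "prime p" and "odd p" and "k > 0" and "q = p ^ k"
    and "CARD('a) = q ^ 2"
    and "\<exists>i. Q = p ^ i" and "\<exists>i. R = p ^ i" and "\<exists>i. S = p ^ i"
    and "r > 0" and "[r = Q + R + S] (mod (q + 1))" and "gcd r (q - 1) = 1"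
    and "f1 = twist_poly q r (B1 Q R S)"
    and "f2 = twist_poly q r (B2 Q R S)"
  shows
    "([int q = 1] (mod 4) \<and> pm_cong4 (Q, R, S) (1, 1, 1) \<and> gcd (Q + R + S) (q + 1) = 1
      \<or> [int q = -1] (mod 4) \<and> pm_cong4 (Q, R, S) (1, 1, 1) \<and> gcd (Q + R + S) (q - 1) = 1
      \<or> [int q = 1] (mod 4) \<and> pm_cong4 (Q, R, S) (1, 1, -1) \<and> gcd (int Q + int R - int S) (int q + 1) = 1
      \<longrightarrow> permutes_field f1) \<and>
     ([int q = 1] (mod 4) \<and> pm_cong4 (Q, R, S) (1, 1, -1) \<and> gcd (Q + R + S) (q + 1) = 1
      \<or> [int q = -1] (mod 4) \<and> pm_cong4 (Q, R, S) (1, 1, -1) \<and> gcd (Q + R + S) (q - 1) = 1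
      \<or> [int q = 1] (mod 4) \<and> pm_cong4 (Q, R, S) (1, 1, 1) \<and> gcd (int Q + int R - int S) (int q + 1) = 1
      \<or> [int q = 1] (mod 4) \<and> pm_cong4 (Q, R, S) (1, -1, 1) \<and> gcd (int Q - int R - int S) (int q + 1) = 1
      \<longrightarrow> permutes_field f2)"
proof -
  \<comment> \<open>The common sign \<open>s\<close> only negates the exponent of the power map, which leaves the gcd alone.\<close>
  have core: "permutes_field (twist_poly q r B)"
    if signs: "a \<in> {1, -1}" "b \<in> {1, -1}" "c \<in> {1, -1}" "d \<in> {1, -1}" "\<epsilon> \<in> {1, -1}"
      and mod4: "[int q = \<epsilon>] (mod 4)" "pm_cong4 (Q, R, S) (a, b, c)"
      and B: "\<And>x. poly B x = x ^ (Q + R) + of_int d * (x ^ (Q + S) + x ^ (R + S)) - 1"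
      and cop: "gcd (a * int Q + b * int R + d * c * int S) (int q + \<epsilon>) = 1"
      and eq_signs: "\<epsilon> = -1 \<longrightarrow> a = b \<and> b = d * c"
    for a b c d \<epsilon> :: int and B :: "'a poly"
  proof -
    obtain s :: int where s: "s \<in> {1, -1}"
      "[int Q = s * a] (mod 4)" "[int R = s * b] (mod 4)" "[int S = s * c] (mod 4)"
      using mod4(2) unfolding pm_cong4_def prod.case by blast
    have "s * a * int Q + s * b * int R + d * (s * c) * int S = s * (a * int Q + b * int R + d * c * int S)"
      by (simp add: algebra_simps)
    moreover have "gcd (s * n) m = gcd n m" for n m
      using s(1) by auto
    ultimately have "gcd (s * a * int Q + s * b * int R + d * (s * c) * int S) (int q + \<epsilon>) = 1"
      using cop by simp
    moreover have "s * a \<in> {1, -1}" "s * b \<in> {1, -1}" "s * c \<in> {1, -1}"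
      using s(1) signs by auto
    moreover have "\<epsilon> = -1 \<longrightarrow> s * a = s * b \<and> s * b = d * (s * c)"
      using eq_signs by simp
    ultimately show ?thesis
      by (intro twisted_tangent_permutes[OF assms(1-11) _ _ _ signs(4,5) s(2-4) mod4(1) B])
  qed
  have B1: "poly (B1 Q R S) x = x ^ (Q + R) + of_int 1 * (x ^ (Q + S) + x ^ (R + S)) - 1" for x :: 'a
    by (simp add: B1_def poly_monom algebra_simps)
  have B2: "poly (B2 Q R S) x = x ^ (Q + R) + of_int (-1) * (x ^ (Q + S) + x ^ (R + S)) - 1" for x :: 'a
    by (simp add: B2_def poly_monom algebra_simps)
  have q1: "int (q - 1) = int q - 1"
    using assms(1,4) prime_gt_0_nat by (simp add: of_nat_diff Suc_le_eq)
  have gcd_plus: "gcd (int Q + int R + int S) (int q + 1) = 1" if "gcd (Q + R + S) (q + 1) = 1"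
    using that by (metis gcd_int_int_eq of_nat_1 of_nat_add)
  have gcd_minus: "gcd (int Q + int R + int S) (int q - 1) = 1" if "gcd (Q + R + S) (q - 1) = 1"
    using that by (metis gcd_int_int_eq of_nat_1 of_nat_add q1)
  show ?thesis
    unfolding assms(12,13)
  proof (intro conjI impI; elim disjE conjE)
    assume "[int q = 1] (mod 4)" "pm_cong4 (Q, R, S) (1, 1, 1)" "gcd (Q + R + S) (q + 1) = 1"
    then show "permutes_field (twist_poly q r (B1 Q R S) :: 'a poly)"
      using gcd_plus by (intro core[of 1 1 1 1 1, OF _ _ _ _ _ _ _ B1]) auto
  next
    assume "[int q = -1] (mod 4)" "pm_cong4 (Q, R, S) (1, 1, 1)" "gcd (Q + R + S) (q - 1) = 1"
    then show "permutes_field (twist_poly q r (B1 Q R S) :: 'a poly)"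
      using gcd_minus by (intro core[of 1 1 1 1 "-1", OF _ _ _ _ _ _ _ B1]) auto
  next
    assume "[int q = 1] (mod 4)" "pm_cong4 (Q, R, S) (1, 1, -1)" "gcd (int Q + int R - int S) (int q + 1) = 1"
    then show "permutes_field (twist_poly q r (B1 Q R S) :: 'a poly)"
      by (intro core[of 1 1 "-1" 1 1, OF _ _ _ _ _ _ _ B1]) auto
  next
    assume "[int q = 1] (mod 4)" "pm_cong4 (Q, R, S) (1, 1, -1)" "gcd (Q + R + S) (q + 1) = 1"
    then show "permutes_field (twist_poly q r (B2 Q R S) :: 'a poly)"
      using gcd_plus by (intro core[of 1 1 "-1" "-1" 1, OF _ _ _ _ _ _ _ B2]) auto
  next
    assume "[int q = -1] (mod 4)" "pm_cong4 (Q, R, S) (1, 1, -1)" "gcd (Q + R + S) (q - 1) = 1"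
    then show "permutes_field (twist_poly q r (B2 Q R S) :: 'a poly)"
      using gcd_minus by (intro core[of 1 1 "-1" "-1" "-1", OF _ _ _ _ _ _ _ B2]) auto
  next
    assume "[int q = 1] (mod 4)" "pm_cong4 (Q, R, S) (1, 1, 1)" "gcd (int Q + int R - int S) (int q + 1) = 1"
    then show "permutes_field (twist_poly q r (B2 Q R S) :: 'a poly)"
      by (intro core[of 1 1 1 "-1" 1, OF _ _ _ _ _ _ _ B2]) auto
  next
    assume "[int q = 1] (mod 4)" "pm_cong4 (Q, R, S) (1, -1, 1)" "gcd (int Q - int R - int S) (int q + 1) = 1"
    then show "permutes_field (twist_poly q r (B2 Q R S) :: 'a poly)"
      by (intro core[of 1 "-1" 1 "-1" 1, OF _ _ _ _ _ _ _ B2]) auto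
  qed
qed

end
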